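(* Let $I\subset\mathbb{R}$ be an interval, let $p\in\mathbb{R}\setminus\{0\}$, let $\alpha>0$, and let $u:I\to\mathbb{R}$ be a hyperbolic $p$-convex function on $I$. Then for any $a,b\in I$ with $a<b$, $$u\left(\frac{a+b}{2}\right)\mathcal{C}_{\alpha}(1)\;\leq\; I^{\alpha}_{a+}u(b)+I^{\alpha}_{b-}u(a)\;\leq\;\frac{u(a)+u(b)}{2}\cdot\frac{1}{\cosh\left(\frac{p(b-a)}{2}\right)}\,\mathcal{C}_\alpha(1),$$ where $$\mathcal{C}_{\alpha}(1):=\int_a^b\cosh\left[p\left(x-\frac{a+b}{2}\right)\right]\frac{(b-x)^{\alpha-1}+(x-a)^{\alpha-1}}{\Gamma(\alpha)}\,dx.$$
   Context: A function $f:I\to\mathbb{R}$ is hyperbolic $p$-convex on $I$ if for every closed subinterval $[a,b]\subset I$ (with $a<b$) and all $x\in[a,b]$, $$f(x)\leq \frac{\sinh[p(b-x)]}{\sinh[p(b-a)]}f(a)+\frac{\sinh[p(x-a)]}{\sinh[p(b-a)]}f(b).$$ The Riemann--Liouville fractional integrals of order $\alpha>0$ are $I^\alpha_{a+}f(t)=\frac{1}{\Gamma(\alpha)}\int_a^t(t-s)^{\alpha-1}f(s)\,ds$ for $t\in(a,b]$ and $I^\alpha_{b-}f(t)=\frac{1}{\Gamma(\alpha)}\int_t^b(s-t)^{\alpha-1}f(s)\,ds$ for $t\in[a,b)$, where $\Gamma$ is the Euler gamma function. In particular $I^\alpha_{a+}u(b)=\frac1{\Gamma(\alpha)}\int_a^b(b-s)^{\alpha-1}u(s)\,ds$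 and $I^\alpha_{b-}u(a)=\frac1{\Gamma(\alpha)}\int_a^b(s-a)^{\alpha-1}u(s)\,ds$. *)

theory Defs
  imports "HOL-Analysis.Analysis"
begin

definition hyperbolic_convex_on :: "real \<Rightarrow> real set \<Rightarrow> (real \<Rightarrow> real) \<Rightarrow> bool" where
  "hyperbolic_convex_on p I f \<longleftrightarrow>
     (\<forall>a b. a < b \<longrightarrow> {a..b} \<subseteq> I \<longrightarrow>
        (\<forall>x\<in>{a..b}. f x \<le> sinh (p * (b - x)) / sinh (p * (b - a)) * f a
                         + sinh (p * (x - a)) / sinh (p * (b - a)) * f b))"

text \<open>Riemann--Liouville fractional integrals of order \<open>\<alpha> > 0\<close>, as Lebesgue integrals.
  The first is based at the left endpoint \<open>a\<close> and meant for \<open>t > a\<close>, the second at the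
  right endpoint \<open>b\<close> and meant for \<open>t < b\<close>. Because \<open>0 powr x = 0\<close>, the kernels vanish at
  \<open>s = t\<close>, a null set, so this convention does not affect the integrals.\<close>

definition RL_left :: "real \<Rightarrow> real \<Rightarrow> (real \<Rightarrow> real) \<Rightarrow> real \<Rightarrow> real" where
  "RL_left \<alpha> a f t = 1 / Gamma \<alpha> * (LINT s:{a..t}|lebesgue. (t - s) powr (\<alpha> - 1) * f s)"

definition RL_right :: "real \<Rightarrow> real \<Rightarrow> (real \<Rightarrow> real) \<Rightarrow> real \<Rightarrow> real" where
  "RL_right \<alpha> b f t = 1 / Gamma \<alpha> * (LINT s:{t..b}|lebesgue. (s - t) powr (\<alpha> - 1) * f s)"

text \<open>The constant \<open>\<C>\<^sub>\<alpha>(1)\<close>, with its dependence on \<open>p\<close>, \<open>a\<close> and \<open>b\<close> made explicit.\<close>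

definition C_cosh :: "real \<Rightarrow> real \<Rightarrow> real \<Rightarrow> real \<Rightarrow> real" where
  "C_cosh p \<alpha> a b =
     (LINT x:{a..b}|lebesgue. cosh (p * (x - (a + b) / 2)) *
        (((b - x) powr (\<alpha> - 1) + (x - a) powr (\<alpha> - 1)) / Gamma \<alpha>))"

end

theory Submission
  imports Defs
begin

text \<open>
  Write \<open>c = (a + b) / 2\<close>. The sum of the two fractional integrals is the integral of \<open>u\<close> against
  the kernel \<open>((b - x) powr (\<alpha> - 1) + (x - a) powr (\<alpha> - 1)) / Gamma \<alpha>\<close>, which is nonnegative and
  symmetric about \<open>c\<close>. Reflecting in \<open>c\<close> therefore replaces \<open>u x\<close> by the average of \<open>u x\<close> and
  \<open>u (a + b - x)\<close>, and it is enough to show pointwise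
  \<open>2 * u c * cosh (p * (x - c)) \<le> u x + u (a + b - x)\<close> and
  \<open>u x + u (a + b - x) \<le> (u a + u b) * cosh (p * (x - c)) / cosh (p * (b - a) / 2)\<close>.
  The upper bound (\<open>hyperbolic_convex_reflected_sum_le\<close>) adds the defining inequality at \<open>x\<close> and at
  \<open>a + b - x\<close>. The lower bound (\<open>hyperbolic_convex_midpoint_le\<close>) is the upper bound
  again, on the subinterval with endpoints \<open>x\<close> and \<open>a + b - x\<close> and evaluated at its midpoint \<open>c\<close>.

  Integrating these bounds requires that \<open>u\<close> times a power kernel be integrable. The kernel is
  integrable and \<open>u\<close> is bounded on \<open>[a, b]\<close>, so measurability of \<open>u\<close> suffices. It comes from
  continuity on the open interval (\<open>hyperbolic_convex_imp_continuous_on\<close>): \<open>exp (p * x) * u x\<close>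
  is an ordinary convex function of \<open>exp (2 * p * x)\<close>, since
  \<open>sinh (p * x)\<close> and \<open>cosh (p * x)\<close> span the same functions as \<open>exp (- p * x)\<close> times \<open>1\<close> and
  \<open>exp (2 * p * x)\<close>.
\<close>

section \<open>Pointwise bounds for the symmetrised function\<close>

lemma sinh_sum_ratio:
  fixes p a b x :: real
  assumes "p \<noteq> 0" "a < b"
  shows "(sinh (p * (b - x)) + sinh (p * (x - a))) / sinh (p * (b - a))
           = cosh (p * (x - (a + b) / 2)) / cosh (p * (b - a) / 2)"
proof -
  define h where "h = p * (b - a) / 2"
  define y where "y = p * (x - (a + b) / 2)"
  have "p * (b - x) = h - y" "p * (x - a) = h + y" "p * (b - a) = 2 * h"
    unfolding h_def y_def by (simp_all add: field_simps)
  moreover have "sinh h \<noteq> 0"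
    unfolding h_def using assms by simp
  moreover have "cosh h \<noteq> 0"
    using cosh_real_pos[of h] by linarith
  ultimately show ?thesis
    unfolding h_def[symmetric] y_def[symmetric]
    by (simp add: sinh_add sinh_diff sinh_double divide_simps)
qed

text \<open>The weights of \<open>u a\<close> and \<open>u b\<close> in the defining inequality are exchanged when \<open>x\<close> is replaced by
  \<open>a + b - x\<close>, so in the sum both endpoints carry the same weight, computed in \<open>sinh_sum_ratio\<close>.
  The degenerate interval \<open>a = b\<close> is included because the next lemma applies this one to
  intervals that shrink to their midpoint.\<close>

lemma hyperbolic_convex_reflected_sum_le:
  assumes hc: "hyperbolic_convex_on p I u" and "p \<noteq> 0"
    and "{a..b} \<subseteq> I" and x: "x \<in> {a..b}"
  shows "u x + u (a + b - x)
           \<le> (u a + u b) * (cosh (p * (x - (a + b) / 2)) / cosh (p * (b - a) / 2))"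
proof (cases "a < b")
  case True
  define A where "A = sinh (p * (b - x)) / sinh (p * (b - a))"
  define B where "B = sinh (p * (x - a)) / sinh (p * (b - a))"
  have *: "f z \<le> sinh (p * (b - z)) / sinh (p * (b - a)) * f a
             + sinh (p * (z - a)) / sinh (p * (b - a)) * f b"
    if "z \<in> {a..b}" "f = u" for z f
    using hc True assms(3) that unfolding hyperbolic_convex_on_def by blast
  have "u x \<le> A * u a + B * u b"
    using *[of x u] x unfolding A_def B_def by simp
  moreover have "u (a + b - x) \<le> B * u a + A * u b"
    using *[of "a + b - x" u] x unfolding A_def B_def by simp
  ultimately have "u x + u (a + b - x) \<le> (u a + u b) * (A + B)"
    by (simp add: algebra_simps)
  also have "A + B = cosh (p * (x - (a + b) / 2)) / cosh (p * (b - a) / 2)"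
    using sinh_sum_ratio[OF \<open>p \<noteq> 0\<close> True, of x]
    unfolding A_def B_def by (simp add: add_divide_distrib)
  finally show ?thesis .
next
  case False
  with x have "x = a" "b = a" by auto
  then show ?thesis by simp
qed

lemma hyperbolic_convex_midpoint_le:
  assumes "hyperbolic_convex_on p I u" "p \<noteq> 0" "{a..b} \<subseteq> I" "x \<in> {a..b}"
  shows "2 * u ((a + b) / 2) * cosh (p * (x - (a + b) / 2)) \<le> u x + u (a + b - x)"
proof -
  have main: "2 * u ((a + b) / 2) * cosh (p * (y - (a + b) / 2)) \<le> u y + u (a + b - y)"
    if y: "y \<in> {a..b}" "y \<le> (a + b) / 2" for y
  proof -
    \<comment> \<open>At the midpoint the numerator \<open>cosh\<close> of the upper bound is \<open>1\<close>, and its denominator can be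
      multiplied over to the left.\<close>
    have "{y..a + b - y} \<subseteq> I" "(a + b) / 2 \<in> {y..a + b - y}"
      using y assms(3) by (auto simp: subset_iff)
    from hyperbolic_convex_reflected_sum_le[OF assms(1,2) this]
    have "2 * u ((a + b) / 2) \<le> (u y + u (a + b - y)) / cosh (p * ((a + b) - 2 * y) / 2)"
      by (simp add: field_simps)
    moreover have "cosh (p * ((a + b) - 2 * y) / 2) = cosh (p * (y - (a + b) / 2))"
    proof -
      have "p * ((a + b) - 2 * y) / 2 = - (p * (y - (a + b) / 2))"
        by (simp add: field_simps)
      then show ?thesis by (simp only: cosh_minus)
    qed
    ultimately show ?thesis
      using cosh_real_pos[of "p * (y - (a + b) / 2)"] by (simp add: pos_le_divide_eq)
  qed
  show ?thesis
  proof (cases "x \<le> (a + b) / 2")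
    case True
    then show ?thesis using main assms(4) by blast
  next
    case False
    have "p * ((a + b - x) - (a + b) / 2) = - (p * (x - (a + b) / 2))"
      by (simp add: field_simps)
    then have even: "cosh (p * ((a + b - x) - (a + b) / 2)) = cosh (p * (x - (a + b) / 2))"
      by (simp only: cosh_minus)
    show ?thesis
      using main[of "a + b - x", unfolded even] False assms(4) by (simp add: add.commute)
  qed
qed

section \<open>Continuity and boundedness of hyperbolic convex functions\<close>

lemma hyperbolic_convex_on_minus:
  "hyperbolic_convex_on (- p) I u \<longleftrightarrow> hyperbolic_convex_on p I u"
  unfolding hyperbolic_convex_on_def by simp

text \<open>After multiplication by \<open>exp (p * x)\<close>, the hyperbolic weights become the weights of linear
  interpolation in the variable \<open>exp (2 * p * x)\<close>, up to factors that depend only on the endpoints.\<close>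

lemma sinh_ratio_exp:
  fixes p a b x :: real
  shows "exp (p * x) * (sinh (p * (b - x)) / sinh (p * (b - a)))
     = exp (p * a) * ((exp (2 * p * b) - exp (2 * p * x)) / (exp (2 * p * b) - exp (2 * p * a)))"
    and "exp (p * x) * (sinh (p * (x - a)) / sinh (p * (b - a)))
     = exp (p * b) * ((exp (2 * p * x) - exp (2 * p * a)) / (exp (2 * p * b) - exp (2 * p * a)))"
proof -
  have sinh_exp: "2 * exp (p * z) * exp (p * y) * sinh (p * (y - z))
                    = exp (2 * p * y) - exp (2 * p * z)" for y z
  proof -
    have "exp (2 * p * y) = exp (p * y) * exp (p * y)" "exp (2 * p * z) = exp (p * z) * exp (p * z)"
      by (simp_all add: exp_add[symmetric])
    moreover have "sinh (p * (y - z)) = (exp (p * y) / exp (p * z) - exp (p * z) / exp (p * y)) / 2"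
      by (simp add: sinh_field_def right_diff_distrib exp_diff)
    ultimately show ?thesis by (simp add: field_simps)
  qed
  show "exp (p * x) * (sinh (p * (b - x)) / sinh (p * (b - a)))
     = exp (p * a) * ((exp (2 * p * b) - exp (2 * p * x)) / (exp (2 * p * b) - exp (2 * p * a)))"
    unfolding sinh_exp[symmetric] by simp
  show "exp (p * x) * (sinh (p * (x - a)) / sinh (p * (b - a)))
     = exp (p * b) * ((exp (2 * p * x) - exp (2 * p * a)) / (exp (2 * p * b) - exp (2 * p * a)))"
    unfolding sinh_exp[symmetric] by simp
qed

text \<open>In the variable \<open>s = exp (2 * p * x)\<close> the defining inequality is the chord inequality of
  ordinary convexity; the endpoint factors left over in \<open>sinh_ratio_exp\<close> are just the
  values of \<open>exp (p * x)\<close> there. Taking \<open>p > 0\<close> makes the substitution increasing.\<close>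

lemma hyperbolic_convex_imp_convex_exp:
  assumes hc: "hyperbolic_convex_on p {a<..<b} u" and p: "p > 0"
  shows "convex_on {exp (2 * p * a)<..<exp (2 * p * b)}
           (\<lambda>s. exp (p * (ln s / (2 * p))) * u (ln s / (2 * p)))"
proof (rule convex_on_linorderI)
  define L where "L s = ln s / (2 * p)" for s :: real
  fix t y z :: real
  assume t: "t > 0" "t < 1" and y: "y \<in> {exp (2 * p * a)<..<exp (2 * p * b)}"
    and z: "z \<in> {exp (2 * p * a)<..<exp (2 * p * b)}" and yz: "y < z"
  define w where "w = (1 - t) *\<^sub>R y + t *\<^sub>R z"
  have pos: "y > 0" "z > 0"
    using y z exp_gt_zero[of "2 * p * a"] by (simp_all del: exp_gt_zero)
  have w: "y < w" "w < z"
  proof -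
    have "w - y = t * (z - y)"
      unfolding w_def by (simp add: algebra_simps)
    moreover have "t * (z - y) > 0"
      using t yz by simp
    ultimately show "y < w" by linarith
    have "z - w = (1 - t) * (z - y)"
      unfolding w_def by (simp add: algebra_simps)
    moreover have "(1 - t) * (z - y) > 0"
      using t yz by simp
    ultimately show "w < z" by linarith
  qed
  have expL: "exp (2 * p * L s) = s" if "s > 0" for s
    using that p unfolding L_def by simp
  have expLs: "exp (2 * p * L y) = y" "exp (2 * p * L w) = w" "exp (2 * p * L z) = z"
    using expL pos w by simp_all
  have mono: "L y < L w" "L w < L z"
    using w pos p unfolding L_def by (simp_all add: divide_strict_right_mono)
  have "2 * p * a < ln y" "ln z < 2 * p * b"
    using y z pos by (metis exp_less_cancel_iff exp_ln greaterThanLessThan_iff)+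
  then have "a < L y" "L z < b"
    using p unfolding L_def by (simp_all add: field_simps)
  then have "{L y..L z} \<subseteq> {a<..<b}"
    by auto
  then have "u (L w) \<le> sinh (p * (L z - L w)) / sinh (p * (L z - L y)) * u (L y)
                 + sinh (p * (L w - L y)) / sinh (p * (L z - L y)) * u (L z)"
    using hc mono unfolding hyperbolic_convex_on_def by auto
  then have "exp (p * L w) * u (L w)
     \<le> exp (p * L w) * (sinh (p * (L z - L w)) / sinh (p * (L z - L y)) * u (L y)
                 + sinh (p * (L w - L y)) / sinh (p * (L z - L y)) * u (L z))"
    by simp
  also have "\<dots> = (exp (p * L w) * (sinh (p * (L z - L w)) / sinh (p * (L z - L y)))) * u (L y)
      + (exp (p * L w) * (sinh (p * (L w - L y)) / sinh (p * (L z - L y)))) * u (L z)"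
    by (simp only: distrib_left mult.assoc)
  also have "\<dots> = ((z - w) / (z - y)) * (exp (p * L y) * u (L y))
      + ((w - y) / (z - y)) * (exp (p * L z) * u (L z))"
    unfolding sinh_ratio_exp expLs by (simp add: mult_ac)
  also have "(z - w) / (z - y) = 1 - t"
    using yz unfolding w_def by (simp add: field_simps)
  also have "(w - y) / (z - y) = t"
    using yz unfolding w_def by (simp add: field_simps)
  finally show "exp (p * (ln ((1 - t) *\<^sub>R y + t *\<^sub>R z) / (2 * p)))
       * u (ln ((1 - t) *\<^sub>R y + t *\<^sub>R z) / (2 * p))
     \<le> (1 - t) * (exp (p * (ln y / (2 * p))) * u (ln y / (2 * p)))
       + t * (exp (p * (ln z / (2 * p))) * u (ln z / (2 * p)))"
    unfolding L_def w_def .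
qed simp

lemma hyperbolic_convex_imp_continuous_on:
  assumes hc: "hyperbolic_convex_on p {a<..<b} u" and "p \<noteq> 0"
  shows "continuous_on {a<..<b} u"
proof -
  have *: "continuous_on {a<..<b} u"
    if hc: "hyperbolic_convex_on q {a<..<b} u" and q: "q > 0" for q
  proof -
    define g where "g s = exp (q * (ln s / (2 * q))) * u (ln s / (2 * q))" for s
    have "continuous_on {exp (2 * q * a)<..<exp (2 * q * b)} g"
      unfolding g_def
      by (intro convex_on_continuous hyperbolic_convex_imp_convex_exp that) simp
    then have "continuous_on {a<..<b} (\<lambda>x. g (exp (2 * q * x)))"
      by (rule continuous_on_compose2) (use q in \<open>auto intro!: continuous_intros\<close>)
    then have "continuous_on {a<..<b} (\<lambda>x. exp (- (q * x)) * g (exp (2 * q * x)))"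
      by (intro continuous_intros)
    moreover have "exp (- (q * x)) * g (exp (2 * q * x)) = u x" for x
      using q unfolding g_def by (simp add: exp_minus)
    ultimately show ?thesis by simp
  qed
  show ?thesis
  proof (cases "p > 0")
    case True
    then show ?thesis using * hc by blast
  next
    case False
    then show ?thesis
      using *[of "- p"] hc \<open>p \<noteq> 0\<close> by (simp add: hyperbolic_convex_on_minus)
  qed
qed

text \<open>The defining inequality bounds \<open>u\<close> above by a continuous function \<open>U\<close>. Writing \<open>u x\<close> as the
  reflected sum minus \<open>u (a + b - x)\<close>, the midpoint inequality and the upper bound \<open>U\<close> at the
  reflected point give a continuous lower bound \<open>V\<close>.\<close>

lemma hyperbolic_convex_imp_bounded:
  assumes hc: "hyperbolic_convex_on p I u" and "p \<noteq> 0" and sub: "{a..b} \<subseteq> I" and "a < b"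
  shows "bounded (u ` {a..b})"
proof -
  have sinh_nz: "sinh (p * (b - a)) \<noteq> 0"
    using assms by simp
  define U where "U x = sinh (p * (b - x)) / sinh (p * (b - a)) * u a
                    + sinh (p * (x - a)) / sinh (p * (b - a)) * u b" for x
  define V where "V x = 2 * u ((a + b) / 2) * cosh (p * (x - (a + b) / 2)) - U (a + b - x)" for x
  have cU: "continuous_on S U" for S
    unfolding U_def using sinh_nz by (intro continuous_intros) auto
  have cV: "continuous_on {a..b} V"
    unfolding V_def
    by (intro continuous_intros continuous_on_compose2[OF cU[of UNIV]]) auto
  have upper: "u x \<le> U x" if "x \<in> {a..b}" for x
    using hc sub \<open>a < b\<close> that unfolding hyperbolic_convex_on_def U_def by blast
  have lower: "V x \<le> u x" if "x \<in> {a..b}" for x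
    using hyperbolic_convex_midpoint_le[OF hc \<open>p \<noteq> 0\<close> sub that] upper[of "a + b - x"] that
    unfolding V_def by simp
  have "bounded (U ` {a..b})" "bounded (V ` {a..b})"
    using cU cV by (auto intro!: compact_imp_bounded compact_continuous_image)
  then obtain M N where "\<forall>x\<in>{a..b}. \<bar>U x\<bar> \<le> M" "\<forall>x\<in>{a..b}. \<bar>V x\<bar> \<le> N"
    unfolding bounded_iff by auto
  then have "\<forall>x\<in>{a..b}. \<bar>u x\<bar> \<le> max M N"
    using upper lower by (smt (verit))
  then show ?thesis
    unfolding bounded_iff by auto
qed

section \<open>Integrability against the power kernels\<close>

lemma has_integral_reflect_interval:
  fixes f :: "real \<Rightarrow> real"
  assumes "(f has_integral i) {a..b}"
  shows "((\<lambda>x. f (a + b - x)) has_integral i) {a..b}"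
proof -
  have "((\<lambda>x. f (- x)) has_integral i) {- b..- a}"
    using assms by simp
  then have "((\<lambda>x. f (- x)) has_integral i) {a + - (a + b)..b + - (a + b)}"
    by simp
  then have "((\<lambda>x. f (- x)) \<circ> (+) (- (a + b)) has_integral i) {a..b}"
    by (simp only: has_integral_shift_Icc_real)
  then show ?thesis
    by (simp add: o_def algebra_simps)
qed

lemma absolutely_integrable_powr_kernels:
  fixes a b \<alpha> :: real
  assumes "\<alpha> > 0" "a \<le> b"
  shows "(\<lambda>x. (x - a) powr (\<alpha> - 1)) absolutely_integrable_on {a..b}"
    and "(\<lambda>x. (b - x) powr (\<alpha> - 1)) absolutely_integrable_on {a..b}"
proof -
  obtain i where "((\<lambda>x. x powr (\<alpha> - 1)) has_integral i) {0..b - a}"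
    using integrable_on_powr_from_0[of "\<alpha> - 1" "b - a"] assms
    by (auto simp: integrable_on_def)
  then have *: "((\<lambda>x. (x - a) powr (\<alpha> - 1)) has_integral i) {a..b}"
    using has_integral_shift_Icc_real[of "\<lambda>x. x powr (\<alpha> - 1)" "- a" i a b]
    by (simp add: o_def)
  then show "(\<lambda>x. (x - a) powr (\<alpha> - 1)) absolutely_integrable_on {a..b}"
    by (intro nonnegative_absolutely_integrable_1) (auto simp: integrable_on_def)
  from has_integral_reflect_interval[OF *]
  show "(\<lambda>x. (b - x) powr (\<alpha> - 1)) absolutely_integrable_on {a..b}"
    by (intro nonnegative_absolutely_integrable_1) (auto simp: integrable_on_def)
qed

text \<open>A function that is hyperbolic convex on \<open>[a, b]\<close> may jump at \<open>a\<close> and \<open>b\<close>, so continuity gives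
  measurability on the open interval only; the two endpoints form a null set and are added at the
  end.\<close>

lemma hyperbolic_convex_absolutely_integrable_mult:
  fixes k :: "real \<Rightarrow> real"
  assumes hc: "hyperbolic_convex_on p I u" and "p \<noteq> 0" and sub: "{a..b} \<subseteq> I" and "a < b"
    and k: "k absolutely_integrable_on {a..b}"
  shows "(\<lambda>x. k x * u x) absolutely_integrable_on {a..b}"
proof -
  have "hyperbolic_convex_on p {a<..<b} u"
    using hc sub greaterThanLessThan_subseteq_atLeastAtMost_iff[of a b a b]
    unfolding hyperbolic_convex_on_def by (meson order.refl order.trans)
  then have "continuous_on {a<..<b} u"
    by (rule hyperbolic_convex_imp_continuous_on) fact
  then have "u \<in> borel_measurable (lebesgue_on {a<..<b})"
    by (rule continuous_imp_measurable_on_sets_lebesgue) simp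
  moreover have "bounded (u ` {a<..<b})"
    using hyperbolic_convex_imp_bounded[OF assms(1-4)]
    by (rule bounded_subset) (intro image_mono, auto)
  moreover have "k absolutely_integrable_on {a<..<b}"
    using k by (rule set_integrable_subset) auto
  ultimately have "(\<lambda>x. u x * k x) absolutely_integrable_on {a<..<b}"
    by (intro absolutely_integrable_bounded_measurable_product_real) auto
  then have "(\<lambda>x. u x * k x) absolutely_integrable_on {a..b}"
  proof (rule absolutely_integrable_spike_set)
    show "negligible {x \<in> {a..b} - {a<..<b}. u x * k x \<noteq> 0}"
      by (rule negligible_subset[of "{a, b}"]) auto
    show "negligible {x \<in> {a<..<b} - {a..b}. u x * k x \<noteq> 0}"
      by (rule negligible_subset[of "{}"]) auto
  qed
  then show ?thesis
    by (simp add: mult.commute)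
qed

section \<open>The fractional Hermite--Hadamard inequality\<close>

theorem theorem2p1:
  fixes I :: "real set" and p \<alpha> a b :: real and u :: "real \<Rightarrow> real"
  assumes "is_interval I"
    and "p \<noteq> 0"
    and "\<alpha> > 0"
    and "hyperbolic_convex_on p I u"
    and "a \<in> I" and "b \<in> I" and "a < b"
  shows "u ((a + b) / 2) * C_cosh p \<alpha> a b \<le> RL_left \<alpha> a u b + RL_right \<alpha> b u a
    \<and> RL_left \<alpha> a u b + RL_right \<alpha> b u a
        \<le> (u a + u b) / 2 * (1 / cosh (p * (b - a) / 2)) * C_cosh p \<alpha> a b"
proof -
  have sub: "{a..b} \<subseteq> I"
    using assms(1,5,6) by (meson atLeastAtMost_iff is_interval_1 subsetI)
  define K where "K x = ((b - x) powr (\<alpha> - 1) + (x - a) powr (\<alpha> - 1)) / Gamma \<alpha>" for x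
  define J where "J = RL_left \<alpha> a u b + RL_right \<alpha> b u a"
  have Gamma_pos: "Gamma \<alpha> > 0"
    using \<open>\<alpha> > 0\<close> by (rule Gamma_real_pos)
  have K_nonneg: "K x \<ge> 0" for x
    unfolding K_def using Gamma_pos by simp
  note kernels = absolutely_integrable_powr_kernels[OF \<open>\<alpha> > 0\<close> less_imp_le[OF \<open>a < b\<close>]]

  have K_int: "K absolutely_integrable_on {a..b}"
    unfolding K_def using kernels by (intro set_integrable_divide set_integral_add(1))
  have "(\<lambda>x. cosh (p * (x - (a + b) / 2)) * K x) absolutely_integrable_on {a..b}"
  proof (intro absolutely_integrable_bounded_measurable_product_real K_int)
    have c: "continuous_on {a..b} (\<lambda>x. cosh (p * (x - (a + b) / 2)))"
      by (intro continuous_intros)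
    then show "(\<lambda>x. cosh (p * (x - (a + b) / 2))) \<in> borel_measurable (lebesgue_on {a..b})"
      by (rule continuous_imp_measurable_on_sets_lebesgue) simp
    from c show "bounded ((\<lambda>x. cosh (p * (x - (a + b) / 2))) ` {a..b})"
      by (intro compact_imp_bounded compact_continuous_image) auto
  qed simp
  then have C: "((\<lambda>x. cosh (p * (x - (a + b) / 2)) * K x) has_integral C_cosh p \<alpha> a b) {a..b}"
    unfolding C_cosh_def K_def by (rule has_integral_set_lebesgue)

  note mult_u = hyperbolic_convex_absolutely_integrable_mult[OF assms(4,2) sub \<open>a < b\<close>]
  have "((\<lambda>x. 1 / Gamma \<alpha> * ((b - x) powr (\<alpha> - 1) * u x)) has_integral RL_left \<alpha> a u b) {a..b}"
    unfolding RL_left_def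
    by (intro has_integral_mult_right has_integral_set_lebesgue mult_u kernels)
  moreover have "((\<lambda>x. 1 / Gamma \<alpha> * ((x - a) powr (\<alpha> - 1) * u x)) has_integral RL_right \<alpha> b u a) {a..b}"
    unfolding RL_right_def
    by (intro has_integral_mult_right has_integral_set_lebesgue mult_u kernels)
  ultimately have "((\<lambda>x. 1 / Gamma \<alpha> * ((b - x) powr (\<alpha> - 1) * u x)
       + 1 / Gamma \<alpha> * ((x - a) powr (\<alpha> - 1) * u x)) has_integral J) {a..b}"
    unfolding J_def by (rule has_integral_add)
  then have Ku: "((\<lambda>x. K x * u x) has_integral J) {a..b}"
    unfolding K_def by (simp add: add_divide_distrib algebra_simps)
  have "K (a + b - x) = K x" for x
    unfolding K_def by (simp add: add.commute)
  then have "((\<lambda>x. K x * u (a + b - x)) has_integral J) {a..b}"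
    using has_integral_reflect_interval[OF Ku] by simp
  from has_integral_add[OF Ku this]
  have sym: "((\<lambda>x. K x * (u x + u (a + b - x))) has_integral 2 * J) {a..b}"
    by (simp add: distrib_left)

  have "2 * u ((a + b) / 2) * C_cosh p \<alpha> a b \<le> 2 * J"
  proof (rule has_integral_le[OF has_integral_mult_right[OF C] sym])
    fix x assume "x \<in> {a..b}"
    from mult_left_mono[OF hyperbolic_convex_midpoint_le[OF assms(4,2) sub this] K_nonneg[of x]]
    show "2 * u ((a + b) / 2) * (cosh (p * (x - (a + b) / 2)) * K x)
            \<le> K x * (u x + u (a + b - x))"
      by (simp add: mult_ac)
  qed
  moreover have "2 * J \<le> (u a + u b) / cosh (p * (b - a) / 2) * C_cosh p \<alpha> a b"
  proof (rule has_integral_le[OF sym has_integral_mult_right[OF C]])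
    fix x assume "x \<in> {a..b}"
    from mult_left_mono[OF hyperbolic_convex_reflected_sum_le[OF assms(4,2) sub this] K_nonneg[of x]]
    show "K x * (u x + u (a + b - x))
            \<le> (u a + u b) / cosh (p * (b - a) / 2) * (cosh (p * (x - (a + b) / 2)) * K x)"
      by (simp add: mult_ac)
  qed
  ultimately show ?thesis
    unfolding J_def by simp
qed

end
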